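(* Let $n\ge 3$ and let $\Gamma$ be any (thin) generalized $n$-gon of order $(s',1)$ with $s'>1$ finite or countable. Then there exist epimorphisms $\varepsilon:\mathcal{A}\to\Gamma$ with $\mathcal{A}$ a thick generalized $n$-gon.
   Context: A point-line geometry $\Gamma=(\mathcal{P},\mathcal{L},\mathbf{I})$ consists of disjoint sets $\mathcal P$ (points) and $\mathcal L$ (lines) with a symmetric incidence relation $\mathbf{I}$ between points and lines. An ordinary $k$-gon is the geometry of $k$ points and $k$ lines whose incidence graph is a cycle of length $2k$ (for $k=2$: two points and two lines, all incident). For $m\ge 3$, $\Gamma$ is a weak generalized $m$-gon if any two elements of $\mathcal{P}\cup\mathcal{L}$ are contained in at least one ordinary sub $m$-gon (as a subgeometry of $\Gamma$), and $\Gamma$ contains no ordinary sub $k$-gons with $2\le k<m$. It is thick (and is then called a thick generalized $m$-gon) if every point is incident with at least three lines and every line with at least three points; otherwise it is thin. It has order $(u,v)$ (possibly infinite cardinals) if each line is incident with exactly $u+1$ points and each point is incident with exactly $v+1$ lines; a (thin) generalized $m$-gon of order $(u,1)$ is a weak generalized $m$-gon having order $(u,1)$. A morphism between weak generalized polygons is a map sending points to points and lines to lines and preserving incidence; an epimorphism is a morphism that is surjective on the point set and on the line set. *)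

theory Defs
  imports Main
begin

unbundle cardinal_syntax

text \<open>
  Points and lines are elements of a common type, so that an element of a geometry (a point or a
  line) and a morphism are single objects; the carriers are required to be disjoint.
\<close>

record 'a geometry =
  points :: "'a set"
  lines :: "'a set"
  inc :: "('a \<times> 'a) set"

definition elements :: "'a geometry \<Rightarrow> 'a set" where
  "elements G = points G \<union> lines G"

definition point_line_geometry :: "'a geometry \<Rightarrow> bool" where
  "point_line_geometry G \<longleftrightarrow>
     points G \<inter> lines G = {} \<and>
     inc G \<subseteq> points G \<times> lines G \<union> lines G \<times> points G \<and>
     sym (inc G)"

definition subgeometry :: "'a geometry \<Rightarrow> 'a geometry \<Rightarrow> bool" where
  "subgeometry H G \<longleftrightarrow>
     point_line_geometry H \<and>
     points H \<subseteq> points G \<and> lines H \<subseteq> lines G \<and>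
     inc H = inc G \<inter> elements H \<times> elements H"

text \<open>
  The incidence graph has the elements as vertices and incidence as adjacency; it is a cycle of
  length \<open>2 * k\<close> if its vertices can be numbered cyclically so that exactly the cyclically
  consecutive ones are adjacent.  Only used for \<open>k \<ge> 2\<close>.
\<close>

definition ordinary_gon :: "nat \<Rightarrow> 'a geometry \<Rightarrow> bool" where
  "ordinary_gon k G \<longleftrightarrow>
     point_line_geometry G \<and>
     finite (points G) \<and> card (points G) = k \<and>
     finite (lines G) \<and> card (lines G) = k \<and>
     (\<exists>x. bij_betw x {..<2 * k} (elements G) \<and>
        (\<forall>i<2 * k. \<forall>j<2 * k.
           (x i, x j) \<in> inc G \<longleftrightarrow> j = Suc i mod (2 * k) \<or> i = Suc j mod (2 * k)))"

definition weak_generalized_gon :: "nat \<Rightarrow> 'a geometry \<Rightarrow> bool" where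
  "weak_generalized_gon m G \<longleftrightarrow>
     point_line_geometry G \<and>
     (\<forall>a\<in>elements G. \<forall>b\<in>elements G.
        \<exists>H. subgeometry H G \<and> ordinary_gon m H \<and> a \<in> elements H \<and> b \<in> elements H) \<and>
     (\<forall>k. 2 \<le> k \<and> k < m \<longrightarrow> \<not> (\<exists>H. subgeometry H G \<and> ordinary_gon k H))"

definition points_on :: "'a geometry \<Rightarrow> 'a \<Rightarrow> 'a set" where
  "points_on G l = {p \<in> points G. (p, l) \<in> inc G}"

definition lines_through :: "'a geometry \<Rightarrow> 'a \<Rightarrow> 'a set" where
  "lines_through G p = {l \<in> lines G. (p, l) \<in> inc G}"

text \<open>Degrees may be infinite, so ``at least three'' is expressed by a three-element subset.\<close>

definition thick :: "'a geometry \<Rightarrow> bool" where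
  "thick G \<longleftrightarrow>
     (\<forall>p\<in>points G. \<exists>T\<subseteq>lines_through G p. card T = 3) \<and>
     (\<forall>l\<in>lines G. \<exists>T\<subseteq>points_on G l. card T = 3)"

definition thick_generalized_gon :: "nat \<Rightarrow> 'a geometry \<Rightarrow> bool" where
  "thick_generalized_gon m G \<longleftrightarrow> weak_generalized_gon m G \<and> thick G"

text \<open>
  The parameters \<open>u\<close> and \<open>v\<close> of an order are arbitrary cardinals; \<open>cone\<close> is the cardinal one.
\<close>

definition has_order :: "'a geometry \<Rightarrow> 'u rel \<Rightarrow> 'v rel \<Rightarrow> bool" where
  "has_order G u v \<longleftrightarrow>
     Card_order u \<and> Card_order v \<and>
     (\<forall>l\<in>lines G. |points_on G l| =o u +c cone) \<and>
     (\<forall>p\<in>points G. |lines_through G p| =o v +c cone)"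

definition morphism :: "'a geometry \<Rightarrow> 'b geometry \<Rightarrow> ('a \<Rightarrow> 'b) \<Rightarrow> bool" where
  "morphism G H f \<longleftrightarrow>
     f ` points G \<subseteq> points H \<and> f ` lines G \<subseteq> lines H \<and>
     (\<forall>a b. (a, b) \<in> inc G \<longrightarrow> (f a, f b) \<in> inc H)"

definition epimorphism :: "'a geometry \<Rightarrow> 'b geometry \<Rightarrow> ('a \<Rightarrow> 'b) \<Rightarrow> bool" where
  "epimorphism G H f \<longleftrightarrow>
     morphism G H f \<and> f ` points G = points H \<and> f ` lines G = lines H"

text \<open>
  HOL cannot quantify existentially over types, so an existence claim about a geometry that maps
  onto a countable one is made over the carrier type \<^typ>\<open>nat\<close>.  This loses nothing: the axioms of
  a thick generalized \<open>m\<close>-gon are first-order, so by the downward Loewenheim-Skolem theorem any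
  thick generalized \<open>m\<close>-gon with an epimorphism onto a countable geometry contains a countable one
  whose restricted map is still an epimorphism.  A weak generalized \<open>m\<close>-gon of order
  \<open>(u, 1)\<close> with \<open>u\<close> at most countable is itself countable, since any two of its elements are
  joined by a finite path in its incidence graph.
\<close>

end

(*
  The polygon A is a free construction over Gamma.  Fix a map f from the natural numbers onto the
  countably many elements of Gamma, with infinite fibres, and build an incidence graph on the natural
  numbers as an increasing union of finite graphs of girth at least 2n whose edges lie over
  incidences of Gamma.  Such a graph can be extended so that a given vertex gets three neighbours
  (new leaves), and so that two given vertices, whose types allow distance n - 1,
  are joined by a walk of length less than n: if they are not, their distance is at least n + 1, and a
  new path of length n - 1 does not spoil the girth.  The new path can be mapped to Gamma because
  any two elements of Gamma of these types are joined by a walk (with backtracking) of length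
  exactly n - 1; injectivity is not required of a morphism.  The union then has girth 2n,
  diameter n and all valencies at least three, which makes it a thick generalized n-gon.
*)

theory Submission
  imports Defs "HOL-Library.Countable_Set_Type"
begin

section \<open>Walks and girth\<close>

text \<open>
  A cycle of length \<open>k + 1\<close> through an edge is a walk of length \<open>k\<close> between its ends that avoids the
  edge; in this form no distinctness of vertices has to be carried along.
\<close>

definition girth_ge :: "nat \<Rightarrow> 'v rel \<Rightarrow> bool" where
  "girth_ge m E \<longleftrightarrow> (\<forall>(u, v)\<in>E. \<forall>k. Suc k < m \<longrightarrow> (u, v) \<notin> (E - {(u, v), (v, u)}) ^^ k)"

lemma girth_geD: "girth_ge m E \<Longrightarrow> (u, v) \<in> E \<Longrightarrow> Suc k < m \<Longrightarrow> (u, v) \<notin> (E - {(u, v), (v, u)}) ^^ k"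
  unfolding girth_ge_def by blast

lemma relpow_subset:
  fixes A B :: "'v rel"
  assumes "A \<subseteq> B" and "(u, v) \<in> A ^^ k"
  shows "(u, v) \<in> B ^^ k"
  using assms(2) by (induction k arbitrary: v) (use assms(1) in auto)

lemma relpow_sym:
  assumes "sym E" and "(u, v) \<in> E ^^ k"
  shows "(v, u) \<in> E ^^ k"
  using assms(2)
proof (induction k arbitrary: u v)
  case (Suc k)
  then obtain w where "(u, w) \<in> E ^^ k" "(w, v) \<in> E" by auto
  with Suc.IH assms(1) show ?case by (meson relpow_Suc_I2 symD)
qed auto

lemma relpow_along:
  assumes "i \<le> j" and "\<And>k. i \<le> k \<Longrightarrow> k < j \<Longrightarrow> (x k, x (Suc k)) \<in> E"
  shows "(x i, x j) \<in> E ^^ (j - i)"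
  unfolding relpow_fun_conv by (rule exI[of _ "\<lambda>k. x (i + k)"]) (use assms in auto)

lemma relpow_parity:
  assumes "\<And>x y. (x, y) \<in> E \<Longrightarrow> c x \<noteq> c y" and "(u, v) \<in> E ^^ k"
  shows "(c u \<longleftrightarrow> c v) \<longleftrightarrow> even k"
  using assms(2) by (induction k arbitrary: v) (auto dest!: assms(1))

text \<open>Cut the walk before its first and after its last use of the new edge. If the cut ends
  agree, the middle part is dropped and an old walk remains; otherwise one crossing replaces the
  middle part.\<close>

lemma relpow_insert_edge:
  assumes "(u, v) \<in> (R \<union> {(p, q), (q, p)}) ^^ k"
  shows "(\<exists>j\<le>k. (u, v) \<in> R ^^ j) \<or>
    (\<exists>i j. i + j < k \<and> ((u, p) \<in> R ^^ i \<and> (q, v) \<in> R ^^ j \<or> (u, q) \<in> R ^^ i \<and> (p, v) \<in> R ^^ j))"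
  using assms
proof (induction k arbitrary: u)
  case 0
  then show ?case by auto
next
  case (Suc k)
  from relpow_Suc_D2[OF Suc.prems] obtain w
    where uw: "(u, w) \<in> R \<union> {(p, q), (q, p)}" and "(w, v) \<in> (R \<union> {(p, q), (q, p)}) ^^ k"
    by blast
  from Suc.IH[OF this(2)] consider
      (old) j where "j \<le> k" "(w, v) \<in> R ^^ j"
    | (new) i j a b where "i + j < k" "(w, a) \<in> R ^^ i" "(b, v) \<in> R ^^ j" "(a, b) \<in> {(p, q), (q, p)}"
    by blast
  then show ?case
  proof cases
    case old
    show ?thesis
    proof (cases "(u, w) \<in> R")
      case True
      with old show ?thesis by (meson Suc_le_mono relpow_Suc_I2)
    next
      case False
      with uw have "(u, w) \<in> {(p, q), (q, p)}" by blast
      moreover have "0 + j < Suc k" "(u, u) \<in> R ^^ 0" using old by auto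
      ultimately show ?thesis using old by blast
    qed
  next
    case new
    show ?thesis
    proof (cases "(u, w) \<in> R")
      case True
      then have "(u, a) \<in> R ^^ Suc i" "Suc i + j < Suc k" using new by (auto intro: relpow_Suc_I2 simp del: relpow.simps)
      with new show ?thesis by blast
    next
      case False
      with uw have uw': "(u, w) \<in> {(p, q), (q, p)}" by blast
      show ?thesis
      \<comment> \<open>If \<open>u = a\<close>, the crossing can be made at once and the detour
        through \<open>w\<close> is dropped; if \<open>u = b\<close>, the tail from \<open>b\<close>
        to \<open>v\<close> is already an old walk.\<close>
      proof (cases "u = a")
        case True
        have "0 + j < Suc k" "(u, u) \<in> R ^^ 0" using new by auto
        with True new show ?thesis by blast
      next
        case False
        then have "u = b" using uw' new(4) by auto
        then show ?thesis using new by (meson add_lessD1 le_SucI less_imp_le trans_le_add2 le_add2 order_trans)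
      qed
    qed
  qed
qed

text \<open>A short cycle has to use the new edge, because the old girth is large; the rest of that
  cycle would be a short old walk between \<open>p\<close> and \<open>q\<close>.\<close>

lemma girth_ge_insert_edge:
  assumes "sym E" and "girth_ge m E" and far: "\<And>k. Suc k < m \<Longrightarrow> (p, q) \<notin> E ^^ k"
  shows "girth_ge m (E \<union> {(p, q), (q, p)})"
proof -
  let ?E = "E \<union> {(p, q), (q, p)}"
  have far': "(q, p) \<notin> E ^^ k" if "Suc k < m" for k
    using far[OF that] relpow_sym[OF assms(1)] by blast
  have False if uv: "(u, v) \<in> ?E" and k: "Suc k < m" and w: "(u, v) \<in> (?E - {(u, v), (v, u)}) ^^ k" for u v k
  proof (cases "(u, v) \<in> {(p, q), (q, p)}")
    case True
    then have "?E - {(u, v), (v, u)} \<subseteq> E" by blast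
    from relpow_subset[OF this w] True far[OF k] far'[OF k] show False by auto
  next
    case False
    let ?R = "E - {(u, v), (v, u)}"
    have symR: "sym ?R" using assms(1) by (auto simp: sym_def)
    from False uv have uvE: "(u, v) \<in> E" by blast
    have "?E - {(u, v), (v, u)} \<subseteq> ?R \<union> {(p, q), (q, p)}" by blast
    from relpow_insert_edge[OF relpow_subset[OF this w]]
    consider (old) j where "j \<le> k" "(u, v) \<in> ?R ^^ j"
      | (new) i j a b where "i + j < k" "(u, a) \<in> ?R ^^ i" "(b, v) \<in> ?R ^^ j" "(a, b) \<in> {(p, q), (q, p)}"
      by blast
    then show False
    proof cases
      case old
      with girth_geD[OF assms(2) uvE, of j] k show False by auto
    next
      case new
      \<comment> \<open>The rest of the cycle, read from the new edge: back from \<open>a\<close> to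
        \<open>u\<close>, across the edge \<open>(u, v)\<close>, then from \<open>v\<close> to
        \<open>b\<close>.\<close>
      have "(a, u) \<in> E ^^ i" "(v, b) \<in> E ^^ j"
        using relpow_sym[OF symR new(2)] relpow_sym[OF symR new(3)] relpow_subset[of ?R E] by blast+
      moreover have "(u, v) \<in> E ^^ 1" using uvE by simp
      ultimately have "(a, b) \<in> E ^^ (i + 1 + j)" by (blast intro: relpow_trans)
      moreover have "Suc (i + 1 + j) < m" using new(1) k by simp
      ultimately show False using far far' new(4) by blast
    qed
  qed
  then show ?thesis unfolding girth_ge_def by blast
qed

text \<open>No old edge leaves \<open>y\<close>, so its only exit is \<open>x\<close>. The strict
  bound makes each pendant vertex one step further from \<open>b\<close> than its
  predecessor.\<close>

lemma relpow_pendant: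
  assumes "\<And>z. (y, z) \<notin> E" and "y \<noteq> x" and "y \<noteq> b" and "(y, b) \<in> (E \<union> {(x, y), (y, x)}) ^^ k"
  shows "\<exists>j<k. (x, b) \<in> E ^^ j"
proof -
  have stuck: "z = y" if "(y, z) \<in> E ^^ i" for z i
    using that assms(1) by (cases i) (auto dest: relpow_Suc_D2 simp del: relpow.simps(2))
  from relpow_insert_edge[OF assms(4)] show ?thesis
    using stuck assms(2,3) by (metis le_add2 order_le_less_trans)
qed

section \<open>Free extension over a given map\<close>

text \<open>
  The vertex set is the whole type \<open>'v\<close> and the map \<open>f\<close> is fixed in advance, so only edges are ever
  added; the infinite fibres provide isolated vertices over any prescribed element.
\<close>

locale fibred_cover =
  fixes I :: "'a rel" and c :: "'a \<Rightarrow> bool" and f :: "'v \<Rightarrow> 'a" and n :: nat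
  assumes sym_I: "sym I"
    and colour: "(g, h) \<in> I \<Longrightarrow> c g \<noteq> c h"
    and fibre: "(f x, h) \<in> I \<Longrightarrow> infinite (f -` {h})"
    and neighbour: "\<exists>h. (f x, h) \<in> I"
    and walk: "(c (f x) \<longleftrightarrow> c (f y)) \<longleftrightarrow> odd n \<Longrightarrow> (f x, f y) \<in> I ^^ (n - 1)"
    and n_ge: "n \<ge> 2"
begin

definition good :: "'v rel \<Rightarrow> bool" where
  "good E \<longleftrightarrow> finite E \<and> sym E \<and> (\<forall>(x, y)\<in>E. (f x, f y) \<in> I) \<and> girth_ge (2 * n) E"

lemma good_insert_edge:
  assumes "good E" and "(f x, f y) \<in> I" and "\<And>k. Suc k < 2 * n \<Longrightarrow> (x, y) \<notin> E ^^ k"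
  shows "good (E \<union> {(x, y), (y, x)})"
proof -
  have "girth_ge (2 * n) (E \<union> {(x, y), (y, x)})"
    using assms by (intro girth_ge_insert_edge) (auto simp: good_def)
  moreover have "sym (E \<union> {(x, y), (y, x)})" using assms(1) by (auto simp: good_def sym_def)
  ultimately show ?thesis using assms symD[OF sym_I assms(2)] by (auto simp: good_def)
qed

text \<open>A vertex outside \<open>Field E\<close> is reached by no walk from \<open>x\<close>, so
  joining it closes no cycle. \<open>B\<close> keeps the new vertex off the target of a path or off
  the neighbours already chosen.\<close>

lemma pendant:
  assumes "good E" and "(f x, h) \<in> I" and "finite B"
  obtains y where "f y = h" and "y \<notin> Field E" and "y \<notin> B" and "y \<noteq> x" and "good (E \<union> {(x, y), (y, x)})"
proof -
  have "finite (Field E \<union> B \<union> {x})" using assms by (auto simp: good_def finite_Field)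
  with fibre[OF assms(2)] obtain y where "y \<in> f -` {h}" "y \<notin> Field E \<union> B \<union> {x}"
    by (meson finite_subset subsetI)
  then have y: "f y = h" "y \<notin> Field E" "y \<notin> B" "y \<noteq> x" by auto
  have "(x, y) \<notin> E ^^ k" for k
    using y(2,4) by (cases k) (auto intro: FieldI2)
  with y assms good_insert_edge have "good (E \<union> {(x, y), (y, x)})" by blast
  with y that show ?thesis by blast
qed

text \<open>The walk in the base is lifted to fresh pendant vertices one at a time, and each of them
  adds one to the lower bound on the distance to \<open>b\<close>.\<close>

lemma extend_path:
  assumes "good E" and "\<And>k. k < m \<Longrightarrow> (a, b) \<notin> E ^^ k" and "(f a, h) \<in> I ^^ j"
  shows "\<exists>E' x. good E' \<and> E \<subseteq> E' \<and> f x = h \<and> (a, x) \<in> E' ^^ j \<and> (\<forall>k<m + j. (x, b) \<notin> E' ^^ k)"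
  using assms(3)
proof (induction j arbitrary: h)
  case 0
  with assms show ?case by (intro exI[of _ E] exI[of _ a]) auto
next
  case (Suc j)
  then obtain g where "(f a, g) \<in> I ^^ j" and gh: "(g, h) \<in> I" by auto
  with Suc.IH obtain E' x where E': "good E'" "E \<subseteq> E'" "f x = g"
    and ax: "(a, x) \<in> E' ^^ j" and far: "\<forall>k<m + j. (x, b) \<notin> E' ^^ k" by blast
  obtain y where y: "f y = h" "y \<notin> Field E'" "y \<notin> {b}" "y \<noteq> x" "good (E' \<union> {(x, y), (y, x)})"
    using pendant[of E' x h "{b}"] E' gh by auto
  have "(y, b) \<notin> (E' \<union> {(x, y), (y, x)}) ^^ k" if "k < m + Suc j" for k
  proof
    assume w: "(y, b) \<in> (E' \<union> {(x, y), (y, x)}) ^^ k"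
    have "\<And>z. (y, z) \<notin> E'" using y(2) by (auto intro: FieldI1)
    from relpow_pendant[OF this y(4) _ w] y(3) obtain i where "i < k" "(x, b) \<in> E' ^^ i" by auto
    with far that show False by auto
  qed
  moreover have "(a, y) \<in> (E' \<union> {(x, y), (y, x)}) ^^ Suc j"
    using relpow_subset[OF _ ax, of "E' \<union> {(x, y), (y, x)}"] by auto
  ultimately show ?case using y E' by blast
qed

text \<open>
  By parity, two elements not joined by a walk shorter than \<open>n\<close> are at distance at least \<open>n + 1\<close>, so a
  fresh path of length \<open>n - 1\<close> between them only closes cycles of length at least \<open>2 * n\<close>.
\<close>

lemma connect:
  assumes "good E" and par: "(c (f a) \<longleftrightarrow> c (f b)) \<longleftrightarrow> odd n"
  shows "\<exists>E'. good E' \<and> E \<subseteq> E' \<and> (\<exists>k<n. (a, b) \<in> E' ^^ k)"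
proof (cases "\<exists>k<n. (a, b) \<in> E ^^ k")
  case True
  with assms show ?thesis by blast
next
  case False
  have "(a, b) \<notin> E ^^ n"
  proof
    assume "(a, b) \<in> E ^^ n"
    moreover have "\<And>x y. (x, y) \<in> E \<Longrightarrow> c (f x) \<noteq> c (f y)"
      using assms(1) colour by (auto simp: good_def)
    ultimately show False using relpow_parity[of E "\<lambda>x. c (f x)" a b n] par by blast
  qed
  with False have far: "(a, b) \<notin> E ^^ k" if "k < n + 1" for k
    using that by (cases "k = n") auto
  \<comment> \<open>Only the first \<open>n - 2\<close> steps are lifted to fresh vertices; the last
    one becomes the edge to \<open>b\<close> itself. Since
    \<open>n + 1 + (n - 2) = 2 * n - 1\<close>, the bound in \<open>far'\<close> is exactly what
    this closing edge needs.\<close>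
  have "n - 1 = Suc (n - 2)" using n_ge by simp
  with walk[OF par] obtain g where g: "(f a, g) \<in> I ^^ (n - 2)" "(g, f b) \<in> I" by auto
  from extend_path[OF assms(1), of "n + 1" a b, OF far g(1)] obtain E' x where
    E': "good E'" "E \<subseteq> E'" "f x = g" and ax: "(a, x) \<in> E' ^^ (n - 2)" and far': "\<forall>k<n + 1 + (n - 2). (x, b) \<notin> E' ^^ k" by auto
  have "good (E' \<union> {(x, b), (b, x)})"
    using good_insert_edge[of E' x b] E' g(2) far' n_ge by auto
  moreover have "(a, b) \<in> (E' \<union> {(x, b), (b, x)}) ^^ Suc (n - 2)"
    using relpow_subset[OF _ ax, of "E' \<union> {(x, b), (b, x)}"] by auto
  moreover have "Suc (n - 2) < n" using n_ge by simp
  ultimately show ?thesis using E'(2) by blast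
qed

text \<open>The new leaves may lie over one and the same element, as a morphism may identify them.
  In this way valency three arises over points with only two lines.\<close>

lemma add_neighbours:
  assumes "good E"
  shows "\<exists>E' T. good E' \<and> E \<subseteq> E' \<and> finite T \<and> card T = m \<and> {a} \<times> T \<subseteq> E'"
proof (induction m)
  case 0
  show ?case using assms by (intro exI[of _ E] exI[of _ "{}"]) auto
next
  case (Suc m)
  then obtain E' T where E': "good E'" "E \<subseteq> E'" "finite T" "card T = m" "{a} \<times> T \<subseteq> E'" by blast
  from neighbour obtain h where "(f a, h) \<in> I" by blast
  from pendant[OF E'(1) this E'(3)] obtain y where "y \<notin> T" "good (E' \<union> {(a, y), (y, a)})" by blast
  with E' show ?case
    by (intro exI[of _ "E' \<union> {(a, y), (y, a)}"] exI[of _ "insert y T"]) auto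
qed

end

section \<open>Limits of increasing chains of graphs\<close>

lemma ex_generic_chain:
  fixes P :: "'x set \<Rightarrow> bool" and R :: "nat \<Rightarrow> 'x set \<Rightarrow> bool"
  assumes "P A" and "\<And>k E. P E \<Longrightarrow> \<exists>E'. P E' \<and> E \<subseteq> E' \<and> R k E'"
  obtains F where "mono F" and "\<And>k. P (F k)" and "\<And>k. R k (F (Suc k))"
proof -
  have "\<exists>F. \<forall>k. P (F k) \<and> (F k \<subseteq> F (Suc k) \<and> R k (F (Suc k)))"
    by (rule dependent_nat_choice) (use assms in auto)
  then obtain F where "\<And>k. P (F k)" "\<And>k. F k \<subseteq> F (Suc k)" "\<And>k. R k (F (Suc k))" by blast
  moreover from this have "mono F" by (simp add: mono_iff_le_Suc)
  ultimately show ?thesis using that by blast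
qed

lemma relpow_UN_mono:
  fixes F :: "nat \<Rightarrow> 'v rel"
  assumes "mono F" and "(u, v) \<in> (\<Union>i. F i) ^^ k"
  shows "\<exists>i. (u, v) \<in> F i ^^ k"
  using assms(2)
proof (induction k arbitrary: v)
  case (Suc k)
  then obtain w j where w: "(u, w) \<in> (\<Union>i. F i) ^^ k" "(w, v) \<in> F j" by auto
  from Suc.IH[OF w(1)] obtain i where i: "(u, w) \<in> F i ^^ k" by blast
  moreover have "F i \<subseteq> F (max i j)" "F j \<subseteq> F (max i j)" using assms(1) by (simp_all add: monoD)
  ultimately have "(u, v) \<in> F (max i j) ^^ Suc k" using relpow_subset[OF _ i] w(2) by auto
  then show ?case by blast
qed auto

text \<open>A cycle is finite, so a short one in the union would already lie in a single
  stage.\<close>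

lemma girth_ge_UN_mono:
  fixes F :: "nat \<Rightarrow> 'v rel"
  assumes "mono F" and girth: "\<And>i. girth_ge m (F i)"
  shows "girth_ge m (\<Union>i. F i)"
proof -
  have False if uv: "(u, v) \<in> F i" and "Suc k < m" and w: "(u, v) \<in> ((\<Union>i. F i) - {(u, v), (v, u)}) ^^ k" for u v i k
  proof -
    have "mono (\<lambda>i. F i - {(u, v), (v, u)})" using assms(1) by (auto simp: mono_def)
    moreover have "(\<Union>i. F i) - {(u, v), (v, u)} = (\<Union>i. F i - {(u, v), (v, u)})" by blast
    ultimately obtain j where j: "(u, v) \<in> (F j - {(u, v), (v, u)}) ^^ k"
      using relpow_UN_mono w by metis
    have "F i \<subseteq> F (max i j)" "F j \<subseteq> F (max i j)" using assms(1) by (simp_all add: monoD)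
    then have "(u, v) \<in> F (max i j)" "(u, v) \<in> (F (max i j) - {(u, v), (v, u)}) ^^ k"
      using uv relpow_subset[OF _ j, of "F (max i j) - {(u, v), (v, u)}"] by blast+
    with girth_geD[OF girth] \<open>Suc k < m\<close> show False by blast
  qed
  then show ?thesis unfolding girth_ge_def by blast
qed

lemma (in fibred_cover) ex_limit:
  assumes "\<exists>e :: nat \<Rightarrow> 'v \<times> 'v. surj e"
  obtains E where "sym E" and "\<And>x y. (x, y) \<in> E \<Longrightarrow> (f x, f y) \<in> I" and "girth_ge (2 * n) E"
    and "\<And>x y. (c (f x) \<longleftrightarrow> c (f y)) \<longleftrightarrow> odd n \<Longrightarrow> \<exists>k<n. (x, y) \<in> E ^^ k"
    and "\<And>x. \<exists>T. card T = 3 \<and> {x} \<times> T \<subseteq> E"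
proof -
  from assms obtain e :: "nat \<Rightarrow> 'v \<times> 'v" where e: "surj e" by blast
  \<comment> \<open>Requirement \<open>k\<close> treats the pair \<open>e k\<close>. It only asks
    for walks and edges to exist, so once met at stage \<open>Suc k\<close> it survives in the
    union.\<close>
  define R where "R k E \<longleftrightarrow>
    (case e k of (a, b) \<Rightarrow> (((c (f a) \<longleftrightarrow> c (f b)) \<longleftrightarrow> odd n) \<longrightarrow> (\<exists>k<n. (a, b) \<in> E ^^ k)) \<and>
      (\<exists>T. card T = 3 \<and> {a} \<times> T \<subseteq> E))" for k E
  have "good {}" by (auto simp: good_def girth_ge_def sym_def)
  moreover have "\<exists>E'. good E' \<and> E \<subseteq> E' \<and> R k E'" if "good E" for k E
  proof -
    obtain a b where ab: "e k = (a, b)" by fastforce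
    obtain E1 T where E1: "good E1" "E \<subseteq> E1" "card T = 3" "{a} \<times> T \<subseteq> E1"
      using add_neighbours[OF \<open>good E\<close>] by blast
    show ?thesis
    proof (cases "(c (f a) \<longleftrightarrow> c (f b)) \<longleftrightarrow> odd n")
      case True
      from connect[OF E1(1) this] obtain E2 where "good E2" "E1 \<subseteq> E2" "\<exists>k<n. (a, b) \<in> E2 ^^ k" by blast
      with E1 show ?thesis unfolding R_def ab by (intro exI[of _ E2]) auto
    next
      case False
      with E1 show ?thesis unfolding R_def ab by (intro exI[of _ E1]) auto
    qed
  qed
  ultimately obtain F where F: "mono F" "\<And>k. good (F k)" "\<And>k. R k (F (Suc k))"
    using ex_generic_chain[of good "{}" R] by blast
  let ?E = "\<Union>k. F k"
  have sub: "F k \<subseteq> ?E" for k by blast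
  show thesis
  proof
    show "sym ?E" using F(2) by (auto simp: good_def intro!: sym_UNION)
    show "(f x, f y) \<in> I" if "(x, y) \<in> ?E" for x y using that F(2) by (fastforce simp: good_def)
    show "girth_ge (2 * n) ?E" using F(2) by (intro girth_ge_UN_mono F(1)) (auto simp: good_def)
    show "\<exists>k<n. (x, y) \<in> ?E ^^ k" if "(c (f x) \<longleftrightarrow> c (f y)) \<longleftrightarrow> odd n" for x y
    proof -
      from e obtain k where "e k = (x, y)" by (metis surjD)
      with F(3)[of k] that have "\<exists>j<n. (x, y) \<in> F (Suc k) ^^ j" by (simp add: R_def)
      with relpow_subset[OF sub] show ?thesis by blast
    qed
    show "\<exists>T. card T = 3 \<and> {x} \<times> T \<subseteq> ?E" for x
    proof -
      from e obtain k where "e k = (x, x)" by (metis surjD)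
      with F(3)[of k] obtain T where "card T = 3" "{x} \<times> T \<subseteq> F (Suc k)" by (auto simp: R_def)
      with sub[of "Suc k"] show ?thesis by (intro exI[of _ T]) auto
    qed
  qed
qed

section \<open>Numberings of ordinary polygons\<close>

lemma ordinary_gon_cycle:
  assumes "ordinary_gon k G"
  obtains x where "inj_on x {..<2 * k}" and "x ` {..<2 * k} = elements G"
    and "\<forall>i<2 * k. \<forall>j<2 * k.
      (x i, x j) \<in> inc G \<longleftrightarrow> j = Suc i mod (2 * k) \<or> i = Suc j mod (2 * k)"
proof -
  from assms obtain x where "bij_betw x {..<2 * k} (elements G)"
    and "\<forall>i<2 * k. \<forall>j<2 * k. (x i, x j) \<in> inc G \<longleftrightarrow> j = Suc i mod (2 * k) \<or> i = Suc j mod (2 * k)"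
    unfolding ordinary_gon_def by (elim conjE exE)
  with that[of x] show ?thesis by (simp add: bij_betw_def)
qed

lemma card_parity_class: "card {i. i < 2 * n \<and> (even i \<longleftrightarrow> b)} = (n::nat)"
proof (cases b)
  case True
  then have "{i. i < 2 * n \<and> (even i \<longleftrightarrow> b)} = (\<lambda>i. 2 * i) ` {..<n}" by (auto elim!: evenE)
  then show ?thesis by (simp add: card_image inj_on_def)
next
  case False
  then have "{i. i < 2 * n \<and> (even i \<longleftrightarrow> b)} = (\<lambda>i. 2 * i + 1) ` {..<n}" by (auto elim!: oddE)
  then show ?thesis by (simp add: card_image inj_on_def)
qed

section \<open>Bipartite graphs of diameter \<open>n\<close> and girth \<open>2 * n\<close>\<close>

text \<open>\<open>branching\<close> gives valency at least two, in the form that lets a path leave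
  a vertex without turning back. \<open>short_walk\<close> covers the pairs with the parity of
  \<open>n - 1\<close>; one more step reaches the others within distance \<open>n\<close>.\<close>

locale polygon_graph =
  fixes E :: "'v rel" and c :: "'v \<Rightarrow> bool" and n :: nat
  assumes sym_E: "sym E"
    and colour: "(x, y) \<in> E \<Longrightarrow> c x \<noteq> c y"
    and girth: "girth_ge (2 * n) E"
    and short_walk: "(c x \<longleftrightarrow> c y) \<longleftrightarrow> odd n \<Longrightarrow> \<exists>k<n. (x, y) \<in> E ^^ k"
    and branching: "\<exists>z. z \<noteq> y \<and> (x, z) \<in> E"
    and n_ge: "n \<ge> 2"
begin

definition dist :: "'v \<Rightarrow> 'v \<Rightarrow> nat" where
  "dist a b = (LEAST k. (a, b) \<in> E ^^ k)"

lemma edge_sym: "(x, y) \<in> E \<Longrightarrow> (y, x) \<in> E"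
  using sym_E by (rule symD)

lemma ex_walk: "\<exists>k\<le>n. (a, b) \<in> E ^^ k"
proof (cases "(c a \<longleftrightarrow> c b) \<longleftrightarrow> odd n")
  case True
  with short_walk show ?thesis by (meson less_imp_le)
next
  case False
  from branching obtain y where y: "(a, y) \<in> E" by blast
  with False colour have "(c y \<longleftrightarrow> c b) \<longleftrightarrow> odd n" by blast
  with short_walk obtain k where "k < n" "(y, b) \<in> E ^^ k" by blast
  with y show ?thesis by (meson Suc_leI relpow_Suc_I2)
qed

lemma dist_walk: "(a, b) \<in> E ^^ dist a b"
  unfolding dist_def using ex_walk by (metis LeastI)

lemma dist_le: "(a, b) \<in> E ^^ k \<Longrightarrow> dist a b \<le> k"
  unfolding dist_def by (rule Least_le)

lemma dist_le_n: "dist a b \<le> n"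
  using ex_walk dist_le order_trans by blast

lemma dist_triangle: "dist a b \<le> dist a w + dist w b"
  by (rule dist_le[OF relpow_trans[OF dist_walk dist_walk]])

lemma dist_self [simp]: "dist a a = 0"
  using dist_le[of a a 0] by simp

lemma dist_0D: "dist a b = 0 \<Longrightarrow> a = b"
  using dist_walk[of a b] by simp

lemma dist_parity: "(c a \<longleftrightarrow> c b) \<longleftrightarrow> even (dist a b)"
  using relpow_parity[of E c a b "dist a b"] colour dist_walk by blast

lemma dist_edge: "(y, z) \<in> E \<Longrightarrow> dist a z = Suc (dist a y) \<or> dist a y = Suc (dist a z)"
proof -
  assume yz: "(y, z) \<in> E"
  have "dist y z \<le> 1" "dist z y \<le> 1" using yz edge_sym by (auto intro: dist_le)
  then have "dist a z \<le> Suc (dist a y)" "dist a y \<le> Suc (dist a z)"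
    using dist_triangle[of a z y] dist_triangle[of a y z] by auto
  moreover have "dist a y \<noteq> dist a z" using dist_parity colour[OF yz] by metis
  ultimately show ?thesis by linarith
qed

text \<open>A walk from \<open>a\<close> shorter than \<open>dist a b\<close> never visits
  \<open>b\<close>, hence uses no edge at \<open>b\<close>.\<close>

lemma walk_avoid:
  assumes "(a, z) \<in> E ^^ k" and "k < dist a b"
  shows "(a, z) \<in> (E - {(b, y), (y, b)}) ^^ k"
proof -
  from assms(1) obtain p where p: "p 0 = a" "p k = z" "\<And>i. i < k \<Longrightarrow> (p i, p (Suc i)) \<in> E"
    unfolding relpow_fun_conv by blast
  have "p i \<noteq> b" if "i \<le> k" for i
    using relpow_along[of 0 i p E] p that dist_le[of a "p i" i] assms(2) by auto
  with p show ?thesis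
    unfolding relpow_fun_conv by (intro exI[of _ p]) auto
qed

text \<open>Going from \<open>b\<close> to \<open>z\<close>, back to \<open>a\<close> and out to
  \<open>y\<close> avoids the edge \<open>(b, y)\<close> and takes \<open>2 * dist a b - 1\<close>
  steps; with this edge it closes up at length \<open>2 * dist a b\<close>, which the girth bounds
  below.\<close>

lemma two_predecessors:
  assumes "(b, y) \<in> E" "(b, z) \<in> E" "y \<noteq> z" "dist a b = Suc (dist a y)" "dist a b = Suc (dist a z)"
  shows "n \<le> dist a b"
proof (rule ccontr)
  assume "\<not> n \<le> dist a b"
  let ?R = "E - {(b, y), (y, b)}"
  have "sym ?R" using sym_E by (auto simp: sym_def)
  have ay: "(a, y) \<in> ?R ^^ dist a y" and az: "(a, z) \<in> ?R ^^ dist a z"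
    using assms(4,5) by (simp_all only: walk_avoid[OF dist_walk] lessI)
  have "(b, z) \<in> ?R ^^ 1" using assms colour by auto
  from relpow_trans[OF relpow_trans[OF this relpow_sym[OF \<open>sym ?R\<close> az]] ay]
  have "(b, y) \<in> ?R ^^ (1 + dist a z + dist a y)" .
  moreover have "Suc (1 + dist a z + dist a y) < 2 * n" using \<open>\<not> n \<le> dist a b\<close> assms by linarith
  ultimately show False using girth_geD[OF girth assms(1)] by blast
qed

text \<open>Of two neighbours of \<open>b\<close> at most one is nearer to \<open>a\<close>, and
  parity excludes equal distance.\<close>

lemma ex_successor:
  assumes "dist a b < n"
  shows "\<exists>y. (b, y) \<in> E \<and> dist a y = Suc (dist a b)"
proof -
  from branching obtain y where y: "(b, y) \<in> E" by blast
  from branching obtain z where z: "z \<noteq> y" "(b, z) \<in> E" by blast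
  from two_predecessors[of b y z a] y z assms dist_edge[OF y, of a] dist_edge[OF z(2), of a]
  show ?thesis by fastforce
qed

section \<open>Geodesics and a cycle through two given vertices\<close>

definition geodesic :: "(nat \<Rightarrow> 'v) \<Rightarrow> 'v \<Rightarrow> nat \<Rightarrow> bool" where
  "geodesic p a m \<longleftrightarrow> (\<forall>i<m. (p i, p (Suc i)) \<in> E) \<and> (\<forall>i\<le>m. dist a (p i) = i)"

lemma geodesicD:
  assumes "geodesic p a m"
  shows "p 0 = a" and "i < m \<Longrightarrow> (p i, p (Suc i)) \<in> E" and "i \<le> m \<Longrightarrow> dist a (p i) = i"
  using assms dist_0D[of a "p 0"] by (auto simp: geodesic_def)

lemma geodesic_dist_end:
  assumes "geodesic p a m" and "i \<le> m"
  shows "dist (p i) (p m) = m - i"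
proof -
  have "dist (p i) (p m) \<le> m - i"
    using geodesicD(2)[OF assms(1)] assms(2) by (intro dist_le relpow_along) auto
  moreover have "m \<le> i + dist (p i) (p m)"
    using dist_triangle[of a "p m" "p i"] geodesicD(3)[OF assms(1)] assms(2) by simp
  ultimately show ?thesis by linarith
qed

lemma ex_geodesic: "\<exists>p. geodesic p a (dist a b) \<and> p (dist a b) = b"
proof -
  let ?m = "dist a b"
  from dist_walk[of a b] obtain p where p: "p 0 = a" "p ?m = b" "\<And>i. i < ?m \<Longrightarrow> (p i, p (Suc i)) \<in> E"
    unfolding relpow_fun_conv by blast
  have "dist a (p i) = i" if "i \<le> ?m" for i
  proof -
    have "dist a (p i) \<le> i" "dist (p i) b \<le> ?m - i"
      using p relpow_along[of 0 i p E] relpow_along[of i ?m p E] that by (auto intro: dist_le)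
    with dist_triangle[of a b "p i"] that show ?thesis by linarith
  qed
  with p show ?thesis unfolding geodesic_def by blast
qed

text \<open>A shortest path from \<open>a\<close> to \<open>b\<close> is prolonged by successors
  until it reaches distance \<open>n\<close>.\<close>

lemma ex_long_geodesic: "\<exists>p. geodesic p a n \<and> p (dist a b) = b"
proof -
  have "\<exists>p. geodesic p a m \<and> p (dist a b) = b" if "dist a b \<le> m" "m \<le> n" for m
    using that
  proof (induction m rule: dec_induct)
    case base
    show ?case by (rule ex_geodesic)
  next
    case (step m)
    then obtain p where p: "geodesic p a m" "p (dist a b) = b" by auto
    with step.prems ex_successor[of a "p m"] obtain y where "(p m, y) \<in> E" "dist a y = Suc m"
      by (auto simp: geodesicD)
    with p step.hyps show ?case
      by (intro exI[of _ "p(Suc m := y)"]) (auto simp: geodesic_def less_Suc_eq le_Suc_eq)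
  qed
  then show ?thesis using dist_le_n by blast
qed

text \<open>The cycle follows a geodesic from \<open>a\<close> through \<open>b\<close> to a vertex
  at distance \<open>n\<close>, leaves that vertex by another edge and returns to \<open>a\<close>
  along a second geodesic.\<close>

lemma ex_cycle_through:
  obtains x where "inj_on x {..<2 * n}" and "\<And>i. i < 2 * n \<Longrightarrow> (x i, x (Suc i mod (2 * n))) \<in> E"
    and "a \<in> x ` {..<2 * n}" and "b \<in> x ` {..<2 * n}"
proof -
  obtain p where p: "geodesic p a n" "p (dist a b) = b" using ex_long_geodesic by blast
  note pD = geodesicD[OF p(1)]
  obtain y where y: "y \<noteq> p (n - 1)" "(p n, y) \<in> E" using branching by blast
  have dy: "dist a y = n - 1"
    using dist_edge[OF y(2), of a] pD(3)[of n] dist_le_n[of a y] by auto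
  with ex_geodesic[of a y] obtain q where q: "geodesic q a (n - 1)" "q (n - 1) = y" by auto
  note qD = geodesicD[OF q(1)]
  \<comment> \<open>Seen from a common inner vertex, \<open>p n\<close> would be at distance
    \<open>n - i < n\<close> with two predecessors, \<open>y\<close> and
    \<open>p (n - 1)\<close>.\<close>
  have apart: "p i \<noteq> q i" if "0 < i" "i < n" for i
  proof
    assume eq: "p i = q i"
    have "dist (p i) (p n) = n - i" "dist (p i) (p (n - 1)) = n - 1 - i"
      using geodesic_dist_end[OF p(1)] geodesic_dist_end[of p a "n - 1" i] p(1) that
      by (auto simp: geodesic_def)
    moreover have "dist (p i) y = n - 1 - i"
      using geodesic_dist_end[OF q(1), of i] that q(2) eq by auto
    moreover have "(p n, p (n - 1)) \<in> E" using pD(2)[of "n - 1"] n_ge edge_sym by auto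
    moreover have "n - i = Suc (n - 1 - i)" using that by simp
    ultimately have "n \<le> n - i"
      using two_predecessors[of "p n" y "p (n - 1)" "p i"] y that by auto
    with that show False by simp
  qed
  \<comment> \<open>Index \<open>n + 1\<close> is \<open>y = q (n - 1)\<close> and index
    \<open>2 * n - 1\<close> is \<open>q 1\<close>; \<open>q 0 = a\<close> is already
    \<open>x 0\<close>. The distance from \<open>a\<close> fixes an index up to the reflection of
    \<open>i\<close> to \<open>2 * n - i\<close>, so \<open>apart\<close> yields
    injectivity.\<close>
  define x where "x i = (if i \<le> n then p i else q (2 * n - i))" for i
  have dx: "dist a (x i) = (if i \<le> n then i else 2 * n - i)" if "i < 2 * n" for i
    using that pD(3) qD(3) by (auto simp: x_def)
  show thesis
  proof
    show "inj_on x {..<2 * n}"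
    proof (rule linorder_inj_onI)
      fix i j assume ij: "i < j" "i \<in> {..<2 * n}" "j \<in> {..<2 * n}"
      show "x i \<noteq> x j"
      proof
        assume eq: "x i = x j"
        then have "i \<le> n" "n < j" "i = 2 * n - j"
          using dx[of i] dx[of j] ij by (auto split: if_splits)
        moreover from this ij have "0 < i" "i < n" by auto
        ultimately show False using eq apart[of i] by (simp add: x_def)
      qed
    qed auto
    show "(x i, x (Suc i mod (2 * n))) \<in> E" if "i < 2 * n" for i
    proof -
      have "i < n \<or> i = n \<or> n < i \<and> Suc i < 2 * n \<or> n < i \<and> Suc i = 2 * n" using that by linarith
      then consider "i < n" | "i = n" | "n < i" "Suc i < 2 * n" | "n < i" "Suc i = 2 * n" by blast
      then show ?thesis
      proof cases
        case 1
        then show ?thesis using pD(2) by (simp add: x_def)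
      next
        case 2
        then show ?thesis using y q(2) n_ge by (simp add: x_def mult_2)
      next
        case 3
        then have "2 * n - i = Suc (2 * n - Suc i)" "2 * n - Suc i < n - 1" by auto
        with 3 qD(2) edge_sym show ?thesis by (simp add: x_def)
      next
        case 4
        then have "2 * n - i = Suc 0" by simp
        with 4 qD(1) qD(2)[of 0] pD(1) edge_sym n_ge show ?thesis by (simp add: x_def)
      qed
    qed
    show "a \<in> x ` {..<2 * n}" using pD(1) n_ge by (force simp: x_def image_iff)
    show "b \<in> x ` {..<2 * n}"
      using dist_le_n[of a b] n_ge p(2) by (intro image_eqI[of _ _ "dist a b"]) (auto simp: x_def)
  qed
qed


text \<open>A chord would close a shorter cycle with the arc from \<open>i\<close> to
  \<open>j\<close>. Subgeometries carry the induced incidence, so the cycle has to be an induced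
  one.\<close>

lemma chordless:
  assumes "inj_on x {..<2 * n}" and step: "\<And>i. i < 2 * n \<Longrightarrow> (x i, x (Suc i mod (2 * n))) \<in> E"
    and i: "i < 2 * n" and j: "j < 2 * n"
  shows "(x i, x j) \<in> E \<longleftrightarrow> j = Suc i mod (2 * n) \<or> i = Suc j mod (2 * n)"
proof
  assume "j = Suc i mod (2 * n) \<or> i = Suc j mod (2 * n)"
  with step i j edge_sym show "(x i, x j) \<in> E" by blast
next
  have *: "j = Suc i mod (2 * n) \<or> i = Suc j mod (2 * n)"
    if edge: "(x i, x j) \<in> E" and "i < j" "j < 2 * n" for i j
  proof (rule ccontr)
    assume "\<not> ?thesis"
    with \<open>i < j\<close> \<open>j < 2 * n\<close> have "Suc i \<noteq> j" "\<not> (i = 0 \<and> Suc j = 2 * n)" by auto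
    then have "Suc (j - i) < 2 * n" using that by linarith
    have "(x k, x (Suc k)) \<in> E - {(x i, x j), (x j, x i)}" if "i \<le> k" "k < j" for k
    proof -
      have "(x k, x (Suc k)) \<in> E" using step[of k] that \<open>j < 2 * n\<close> by simp
      moreover have "\<not> (x k = x i \<and> x (Suc k) = x j)" "x k \<noteq> x j"
        using inj_on_eq_iff[OF assms(1)] that \<open>j < 2 * n\<close> \<open>Suc i \<noteq> j\<close> by auto
      ultimately show ?thesis by blast
    qed
    from relpow_along[of i j x "E - {(x i, x j), (x j, x i)}", OF _ this] \<open>i < j\<close>
    have "(x i, x j) \<in> (E - {(x i, x j), (x j, x i)}) ^^ (j - i)" by simp
    with girth_geD[OF girth edge \<open>Suc (j - i) < 2 * n\<close>] show False by blast
  qed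
  assume edge: "(x i, x j) \<in> E"
  with colour have "i \<noteq> j" by auto
  with * edge edge_sym i j show "j = Suc i mod (2 * n) \<or> i = Suc j mod (2 * n)"
    by (metis linorder_neqE_nat)
qed

lemma no_short_gon:
  assumes H: "ordinary_gon k H" "inc H \<subseteq> E" and "2 \<le> k"
  shows "n \<le> k"
proof (rule ccontr)
  assume "\<not> n \<le> k"
  from H(1) obtain x where x: "inj_on x {..<2 * k}" and "x ` {..<2 * k} = elements H"
    and adj: "\<forall>i<2 * k. \<forall>j<2 * k.
      (x i, x j) \<in> inc H \<longleftrightarrow> j = Suc i mod (2 * k) \<or> i = Suc j mod (2 * k)"
    by (rule ordinary_gon_cycle)
  \<comment> \<open>The edge from \<open>x 0\<close> to \<open>x ?m\<close> closes the cycle; the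
    other \<open>2 * k - 1\<close> edges form the walk forbidden by the girth.\<close>
  let ?m = "2 * k - 1"
  have "(x 0, x ?m) \<in> E" using adj[rule_format, of 0 ?m] H(2) \<open>2 \<le> k\<close> by auto
  have "(x i, x (Suc i)) \<in> E - {(x 0, x ?m), (x ?m, x 0)}" if "0 \<le> i" "i < ?m" for i
  proof -
    have "(x i, x (Suc i)) \<in> E" using adj[rule_format, of i "Suc i"] that H(2) by auto
    moreover have "\<not> (x i = x 0 \<and> x (Suc i) = x ?m)" "x i \<noteq> x ?m"
      using inj_on_eq_iff[OF x] that \<open>2 \<le> k\<close> by auto
    ultimately show ?thesis by blast
  qed
  from relpow_along[of 0 ?m x "E - {(x 0, x ?m), (x ?m, x 0)}", OF le0 this]
  have "(x 0, x ?m) \<in> (E - {(x 0, x ?m), (x ?m, x 0)}) ^^ ?m" by (simp only: diff_zero)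
  moreover have "Suc ?m < 2 * n" using \<open>\<not> n \<le> k\<close> \<open>2 \<le> k\<close> by linarith
  ultimately show False using girth_geD[OF girth \<open>(x 0, x ?m) \<in> E\<close>] by blast
qed

lemma weak_generalized_gon:
  "weak_generalized_gon n \<lparr>points = {x. c x}, lines = {x. \<not> c x}, inc = E\<rparr>" (is "weak_generalized_gon n ?G")
proof -
  have geo: "point_line_geometry ?G"
    using colour sym_E by (auto simp: point_line_geometry_def)
  have "\<exists>H. subgeometry H ?G \<and> ordinary_gon n H \<and> a \<in> elements H \<and> b \<in> elements H" for a b
  proof -
    obtain x where x: "inj_on x {..<2 * n}"
      and step: "\<And>i. i < 2 * n \<Longrightarrow> (x i, x (Suc i mod (2 * n))) \<in> E"
      and ab: "a \<in> x ` {..<2 * n}" "b \<in> x ` {..<2 * n}"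
      using ex_cycle_through[of a b] by metis
    let ?X = "x ` {..<2 * n}"
    define H where "H = \<lparr>points = {v \<in> ?X. c v}, lines = {v \<in> ?X. \<not> c v}, inc = E \<inter> ?X \<times> ?X\<rparr>"
    have elems: "elements H = ?X" by (auto simp: H_def elements_def)
    have "subgeometry H ?G"
      using geo elems by (auto simp: subgeometry_def point_line_geometry_def H_def sym_def)
    moreover have "ordinary_gon n H"
    proof -
      define b where "b = c (x 0)"
      \<comment> \<open>Colours alternate along the cycle, so points and lines are its two parity
        classes, of size \<open>n\<close> each.\<close>
      have par: "c (x i) \<longleftrightarrow> (even i \<longleftrightarrow> b)" if "i < 2 * n" for i
        using that
      proof (induction i)
        case (Suc i)
        with colour[OF step[of i]] show ?case by auto
      qed (simp add: b_def)
      have "points H = x ` {i. i < 2 * n \<and> c (x i)}" "lines H = x ` {i. i < 2 * n \<and> \<not> c (x i)}"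
        by (auto simp: H_def)
      moreover have "{i. i < 2 * n \<and> c (x i)} = {i. i < 2 * n \<and> (even i \<longleftrightarrow> b)}"
        "{i. i < 2 * n \<and> \<not> c (x i)} = {i. i < 2 * n \<and> (even i \<longleftrightarrow> \<not> b)}"
        using par by blast+
      moreover have "card (x ` {i. i < 2 * n \<and> (even i \<longleftrightarrow> b')}) = n" for b'
      proof -
        have "inj_on x {i. i < 2 * n \<and> (even i \<longleftrightarrow> b')}" by (rule inj_on_subset[OF x]) auto
        then show ?thesis by (simp add: card_image card_parity_class)
      qed
      ultimately have "card (points H) = n" "card (lines H) = n" by simp_all
      moreover have "(x i, x j) \<in> inc H \<longleftrightarrow> j = Suc i mod (2 * n) \<or> i = Suc j mod (2 * n)"
        if "i < 2 * n" "j < 2 * n" for i j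
      proof -
        have "(x i, x j) \<in> inc H \<longleftrightarrow> (x i, x j) \<in> E" using that by (auto simp: H_def)
        with chordless[OF x step that] show ?thesis by (simp only:)
      qed
      moreover have "point_line_geometry H" "finite (points H)" "finite (lines H)"
        using \<open>subgeometry H ?G\<close> by (auto simp: subgeometry_def H_def)
      moreover have "bij_betw x {..<2 * n} (elements H)" using x elems by (simp add: bij_betw_def)
      ultimately show ?thesis unfolding ordinary_gon_def by blast
    qed
    ultimately show ?thesis using ab elems by blast
  qed
  moreover have "n \<le> k" if "2 \<le> k" "subgeometry H ?G" "ordinary_gon k H" for k H
    using no_short_gon[OF that(3) _ that(1)] that(2) by (auto simp: subgeometry_def)
  ultimately show ?thesis using geo unfolding weak_generalized_gon_def by (meson not_le)
qed

end

section \<open>Countable generalized polygons and their covers\<close>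

lemma ordinary_gon_neighbour:
  assumes H: "ordinary_gon m H" and "subgeometry H G" and "a \<in> elements H" and "2 \<le> m"
  shows "\<exists>b. (a, b) \<in> inc G"
proof -
  from H obtain x where "inj_on x {..<2 * m}" and "x ` {..<2 * m} = elements H"
    and adj: "\<forall>i<2 * m. \<forall>j<2 * m.
      (x i, x j) \<in> inc H \<longleftrightarrow> j = Suc i mod (2 * m) \<or> i = Suc j mod (2 * m)"
    by (rule ordinary_gon_cycle)
  with assms(3) obtain i where i: "i < 2 * m" "a = x i" by (metis imageE lessThan_iff)
  have "Suc i mod (2 * m) < 2 * m" using \<open>2 \<le> m\<close> by simp
  with i adj[rule_format] have "(a, x (Suc i mod (2 * m))) \<in> inc H" by auto
  with assms(2) show ?thesis by (auto simp: subgeometry_def)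
qed

text \<open>The two arcs between a pair of vertices have total length \<open>2 * m\<close>, so one
  of them has length at most \<open>m\<close>.\<close>

lemma ordinary_gon_walk:
  assumes H: "ordinary_gon m H" and "subgeometry H G" and "sym (inc G)"
    and "a \<in> elements H" and "b \<in> elements H" and "2 \<le> m"
  shows "\<exists>k\<le>m. (a, b) \<in> inc G ^^ k"
proof -
  from H obtain x where "inj_on x {..<2 * m}" and x: "x ` {..<2 * m} = elements H"
    and adj: "\<forall>i<2 * m. \<forall>j<2 * m.
      (x i, x j) \<in> inc H \<longleftrightarrow> j = Suc i mod (2 * m) \<or> i = Suc j mod (2 * m)"
    by (rule ordinary_gon_cycle)
  \<comment> \<open>The periodic extension turns the arc through index 0 into an interval of
    indices.\<close>
  define y where "y i = x (i mod (2 * m))" for i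
  have step: "(y i, y (Suc i)) \<in> inc G" for i
    using adj[rule_format, of "i mod (2 * m)" "Suc i mod (2 * m)"] assms(2,6)
    by (auto simp: y_def subgeometry_def mod_Suc_eq)
  have *: "\<exists>k\<le>m. (x i, x j) \<in> inc G ^^ k" if "i \<le> j" "j < 2 * m" for i j
  proof (cases "j - i \<le> m")
    case True
    have "y i = x i" "y j = x j" using that by (simp_all add: y_def)
    with relpow_along[of i j y "inc G"] step that True show ?thesis by metis
  next
    case False
    have "y (2 * m + i) = x i" "y j = x j" using that by (simp_all add: y_def)
    with relpow_along[of j "2 * m + i" y "inc G"] step that
    have "(x j, x i) \<in> inc G ^^ (2 * m + i - j)" by auto
    from relpow_sym[OF assms(3) this] have "(x i, x j) \<in> inc G ^^ (2 * m + i - j)" .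
    moreover have "2 * m + i - j \<le> m" using False by simp
    ultimately show ?thesis by blast
  qed
  have "a \<in> x ` {..<2 * m}" "b \<in> x ` {..<2 * m}" unfolding x by (fact assms(4,5))+
  then obtain i j where ij: "i < 2 * m" "a = x i" "j < 2 * m" "b = x j" by blast
  show ?thesis
  proof (cases "i \<le> j")
    case True
    with * ij show ?thesis by blast
  next
    case False
    then have "j \<le> i" by simp
    from *[OF this ij(1)] obtain k where k: "k \<le> m" "(b, a) \<in> inc G ^^ k" unfolding ij by blast
    from k(1) relpow_sym[OF assms(3) k(2)] show ?thesis by blast
  qed
qed

text \<open>Go back and forth \<open>i\<close> times along the edge \<open>(u, w)\<close> before
  setting out.\<close>

lemma relpow_pad:
  assumes "sym R" and "(u, w) \<in> R" and "(u, v) \<in> R ^^ k"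
  shows "(u, v) \<in> R ^^ (2 * i + k)"
proof (induction i)
  case (Suc i)
  with symD[OF assms(1,2)] assms(2) have "(u, v) \<in> R ^^ Suc (Suc (2 * i + k))"
    by (meson relpow_Suc_I2)
  then show ?case by simp
qed (use assms(3) in simp)

lemma cone_ordLeq_natLeq: "cone \<le>o natLeq"
  by (rule cone_ordLeq_Cnotzero[OF Cinfinite_Cnotzero[OF natLeq_Cinfinite]])

lemma countable_order:
  assumes "r \<le>o natLeq" and "|X| =o r +c cone"
  shows "countable X"
proof -
  have "r +c cone \<le>o natLeq +c natLeq" using assms(1) cone_ordLeq_natLeq by (rule csum_mono)
  also have "natLeq +c natLeq =o natLeq"
    by (rule csum_absorb1[OF natLeq_Cinfinite ordLeq_refl[OF natLeq_Card_order]])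
  finally have "|X| \<le>o natLeq" using assms(2) ordIso_ordLeq_trans by blast
  then show ?thesis by (simp add: countable_card_le_natLeq)
qed

lemma weak_generalized_gon_common_gon:
  assumes "weak_generalized_gon m G" and "a \<in> elements G" and "b \<in> elements G"
  obtains H where "subgeometry H G" and "ordinary_gon m H" and "a \<in> elements H" and "b \<in> elements H"
  using assms unfolding weak_generalized_gon_def by blast

text \<open>By induction on \<open>k\<close>, countably many elements are reached from a fixed one
  by walks of length \<open>k\<close>, and common \<open>m\<close>-gons show that every element is
  reached.\<close>

lemma weak_generalized_gon_countable:
  assumes G: "weak_generalized_gon m G" and "2 \<le> m"
    and nbrs: "\<And>a. a \<in> elements G \<Longrightarrow> countable {b. (a, b) \<in> inc G}"
  shows "countable (elements G)"
proof (cases "elements G = {}")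
  case False
  then obtain a where a: "a \<in> elements G" by blast
  have geo: "point_line_geometry G" using G by (simp add: weak_generalized_gon_def)
  have "countable {b. (a, b) \<in> inc G ^^ k}" for k
  proof (induction k)
    case (Suc k)
    have "{b. (a, b) \<in> inc G ^^ Suc k} \<subseteq> (\<Union>w\<in>{w \<in> elements G. (a, w) \<in> inc G ^^ k}. {b. (w, b) \<in> inc G})"
      using geo by (auto simp: point_line_geometry_def elements_def)
    moreover have "countable {w \<in> elements G. (a, w) \<in> inc G ^^ k}"
      by (rule countable_subset[OF _ Suc]) blast
    then have "countable (\<Union>w\<in>{w \<in> elements G. (a, w) \<in> inc G ^^ k}. {b. (w, b) \<in> inc G})"
      using nbrs by (intro countable_UN) auto
    ultimately show ?case using countable_subset by blast
  qed auto
  then have "countable (\<Union>k. {b. (a, b) \<in> inc G ^^ k})" by blast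
  moreover have "elements G \<subseteq> (\<Union>k. {b. (a, b) \<in> inc G ^^ k})"
  proof
    fix b assume "b \<in> elements G"
    with weak_generalized_gon_common_gon[OF G a] obtain H
      where H: "subgeometry H G" "ordinary_gon m H" "a \<in> elements H" "b \<in> elements H" by metis
    with ordinary_gon_walk[OF H(2,1) _ H(3,4) \<open>2 \<le> m\<close>] geo
    show "b \<in> (\<Union>k. {b. (a, b) \<in> inc G ^^ k})" by (auto simp: point_line_geometry_def)
  qed
  ultimately show ?thesis using countable_subset by blast
qed simp

lemma ex_surj_infinite_fibres:
  assumes "countable A" and "A \<noteq> {}"
  obtains f :: "nat \<Rightarrow> 'a" where "range f = A" and "\<And>h. h \<in> A \<Longrightarrow> infinite (f -` {h})"
proof -
  \<comment> \<open>Each number codes a pair and only its first component is read, so every value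
    recurs for all second components.\<close>
  let ?f = "\<lambda>k. from_nat_into A (fst (prod_decode k))"
  show thesis
  proof
    have "range ?f = from_nat_into A ` range (\<lambda>k. fst (prod_decode k))" by auto
    also have "range (\<lambda>k. fst (prod_decode k)) = UNIV"
      by (metis fst_conv prod_encode_inverse surj_def)
    finally show "range ?f = A" using assms range_from_nat_into by metis
    show "infinite (?f -` {h})" if h: "h \<in> A" for h
    proof -
      obtain m where "from_nat_into A m = h" using from_nat_into_surj[OF assms(1) h] by blast
      then have "range (\<lambda>k. prod_encode (m, k)) \<subseteq> ?f -` {h}" by auto
      moreover have "infinite (range (\<lambda>k. prod_encode (m, k)))"
        by (intro range_inj_infinite injI) (simp add: prod_encode_eq)
      ultimately show ?thesis using finite_subset by blast
    qed
  qed
qed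

section \<open>Thick covers of countable generalized polygons\<close>

theorem thick_cover_countable:
  fixes G :: "'a geometry"
  assumes G: "weak_generalized_gon n G" and "2 \<le> n" and "countable (elements G)"
  shows "\<exists>(A :: nat geometry) f. thick_generalized_gon n A \<and> epimorphism A G f"
proof (cases "elements G = {}")
  case True
  \<comment> \<open>No map from \<open>nat\<close> has empty range, so an empty \<open>G\<close> is
    covered separately, by the empty geometry.\<close>
  let ?A = "\<lparr>points = {}, lines = {}, inc = {}\<rparr> :: nat geometry"
  have "weak_generalized_gon n ?A"
    by (auto simp: weak_generalized_gon_def point_line_geometry_def elements_def subgeometry_def
        ordinary_gon_def sym_def)
  then have "thick_generalized_gon n ?A \<and> epimorphism ?A G f" for f
    using True by (auto simp: thick_generalized_gon_def thick_def epimorphism_def morphism_def elements_def)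
  then show ?thesis by blast
next
  case False
  then obtain f :: "nat \<Rightarrow> 'a" where f: "range f = elements G"
    and inf: "\<And>h. h \<in> elements G \<Longrightarrow> infinite (f -` {h})"
    using ex_surj_infinite_fibres[OF assms(3)] by blast
  have geo: "point_line_geometry G" using G by (simp add: weak_generalized_gon_def)
  then have sym: "sym (inc G)" by (simp add: point_line_geometry_def)
  have inc: "(g \<in> points G) \<noteq> (h \<in> points G)" "h \<in> elements G" if "(g, h) \<in> inc G" for g h
    using geo that by (auto simp: point_line_geometry_def elements_def)
  have f_in: "f x \<in> elements G" for x using f by blast
  have nbr: "\<exists>h. (f x, h) \<in> inc G" for x
  proof -
    obtain H where H: "subgeometry H G" "ordinary_gon n H" "f x \<in> elements H"
      using weak_generalized_gon_common_gon[OF G f_in[of x] f_in[of x]] by metis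
    show ?thesis by (rule ordinary_gon_neighbour[OF H(2,1,3) \<open>2 \<le> n\<close>])
  qed
  have walk: "(f x, f y) \<in> inc G ^^ (n - 1)"
    if par: "(f x \<in> points G \<longleftrightarrow> f y \<in> points G) \<longleftrightarrow> odd n" for x y
  proof -
    obtain H where H: "subgeometry H G" "ordinary_gon n H" "f x \<in> elements H" "f y \<in> elements H"
      using weak_generalized_gon_common_gon[OF G f_in[of x] f_in[of y]] by metis
    obtain k where k: "k \<le> n" "(f x, f y) \<in> inc G ^^ k"
      using ordinary_gon_walk[OF H(2,1) sym H(3,4) \<open>2 \<le> n\<close>] by blast
    \<comment> \<open>The walk inside a common \<open>n\<close>-gon has the parity of
      \<open>n - 1\<close>. So \<open>k = n\<close> is excluded, and the missing even number of
      steps is filled by backtracking.\<close>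
    have "even k \<longleftrightarrow> odd n"
      using relpow_parity[of "inc G" "\<lambda>g. g \<in> points G" "f x" "f y" k] inc(1) k(2) par by blast
    with k(1) \<open>2 \<le> n\<close> have "k \<le> n - 1" "even (n - 1 - k)" by (cases "k = n"; auto)+
    then obtain i where "n - 1 = 2 * i + k" by (metis evenE le_add_diff_inverse2)
    with nbr[of x] relpow_pad[OF sym _ k(2)] show ?thesis by auto
  qed
  interpret fibred_cover "inc G" "\<lambda>g. g \<in> points G" f n
    using sym inc inf nbr walk \<open>2 \<le> n\<close> by unfold_locales blast+
  have "\<exists>e :: nat \<Rightarrow> nat \<times> nat. surj e" using surj_prod_decode by blast
  then show ?thesis
  proof (rule ex_limit)
    fix E
    assume E: "sym E" "\<And>x y. (x, y) \<in> E \<Longrightarrow> (f x, f y) \<in> inc G" "girth_ge (2 * n) E"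
        "\<And>x y. (f x \<in> points G \<longleftrightarrow> f y \<in> points G) \<longleftrightarrow> odd n \<Longrightarrow> \<exists>k<n. (x, y) \<in> E ^^ k"
      and deg: "\<And>x. \<exists>T. card T = 3 \<and> {x} \<times> T \<subseteq> E"
    let ?c = "\<lambda>x. f x \<in> points G"
    let ?A = "\<lparr>points = {x. ?c x}, lines = {x. \<not> ?c x}, inc = E\<rparr>"
    \<comment> \<open>The type of a vertex is that of its image, so types are preserved by
      construction and surjectivity comes from the range of \<open>f\<close>.\<close>
    have colour_E: "?c x \<noteq> ?c y" if "(x, y) \<in> E" for x y using E(2)[OF that] inc(1) by blast
    have "\<exists>z. z \<noteq> y \<and> (x, z) \<in> E" for x y
    proof -
      from deg obtain T where T: "card T = 3" "{x} \<times> T \<subseteq> E" by blast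
      then have "\<not> T \<subseteq> {y}" using card_mono[of "{y}" T] by auto
      with T show ?thesis by blast
    qed
    then interpret polygon_graph E ?c n
      using E colour_E \<open>2 \<le> n\<close> by unfold_locales blast+
    have "thick ?A"
    proof -
      have "\<exists>T\<subseteq>lines_through ?A p. card T = 3" if "?c p" for p
      proof -
        from deg obtain T where "card T = 3" "{p} \<times> T \<subseteq> E" by blast
        with that colour_E show ?thesis by (intro exI[of _ T]) (auto simp: lines_through_def)
      qed
      moreover have "\<exists>T\<subseteq>points_on ?A l. card T = 3" if "\<not> ?c l" for l
      proof -
        from deg obtain T where "card T = 3" "{l} \<times> T \<subseteq> E" by blast
        with that colour_E symD[OF E(1)] show ?thesis by (intro exI[of _ T]) (auto simp: points_on_def)
      qed
      ultimately show ?thesis by (simp add: thick_def)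
    qed
    with weak_generalized_gon have "thick_generalized_gon n ?A" by (simp add: thick_generalized_gon_def)
    moreover have "epimorphism ?A G f"
    proof -
      have "f ` {x. ?c x} = range f \<inter> points G" "f ` {x. \<not> ?c x} = range f - points G" by auto
      then have "f ` {x. ?c x} = points G" "f ` {x. \<not> ?c x} = lines G"
        unfolding f using geo by (auto simp: elements_def point_line_geometry_def)
      with E(2) show ?thesis by (simp add: epimorphism_def morphism_def)
    qed
    ultimately show ?thesis by blast
  qed
qed

theorem proposition6p1:
  fixes n :: nat and \<Gamma> :: "'a geometry" and s' :: "'s rel"
  assumes "n \<ge> 3"
    and "weak_generalized_gon n \<Gamma>"
    and "has_order \<Gamma> s' cone"
    and "cone <o s'" and "s' \<le>o natLeq"
  shows "\<exists>(\<A> :: nat geometry) \<epsilon>. thick_generalized_gon n \<A> \<and> epimorphism \<A> \<Gamma> \<epsilon>"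
proof -
  have geo: "point_line_geometry \<Gamma>" using assms(2) by (simp add: weak_generalized_gon_def)
  \<comment> \<open>A point is on \<open>1 + 1\<close> lines and a line has \<open>s' + 1\<close>
    points, both countable; this makes the whole geometry countable.\<close>
  have "countable {b. (a, b) \<in> inc \<Gamma>}" if "a \<in> elements \<Gamma>" for a
  proof (cases "a \<in> points \<Gamma>")
    case True
    then have "{b. (a, b) \<in> inc \<Gamma>} = lines_through \<Gamma> a"
      using geo by (auto simp: point_line_geometry_def lines_through_def)
    moreover have "|lines_through \<Gamma> a| =o cone +c cone" using True assms(3) by (simp add: has_order_def)
    ultimately show ?thesis using countable_order[OF cone_ordLeq_natLeq] by simp
  next
    case False
    with that have a: "a \<in> lines \<Gamma>" by (simp add: elements_def)
    then have "{b. (a, b) \<in> inc \<Gamma>} = points_on \<Gamma> a"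
      using geo by (auto simp: point_line_geometry_def points_on_def sym_def)
    moreover have "|points_on \<Gamma> a| =o s' +c cone" using a assms(3) by (simp add: has_order_def)
    ultimately show ?thesis using countable_order[OF assms(5)] by simp
  qed
  with assms(1,2) have "countable (elements \<Gamma>)"
    by (intro weak_generalized_gon_countable[of n]) auto
  with assms(1,2) show ?thesis by (intro thick_cover_countable) auto
qed

end
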